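(* For all integers $m\ge 1$ and $n\ge 9\lceil m/5\rceil$, we have $.M.(m,n)<m+n-1$.
   Context: Knuth's restricted-adversary functions $\lambda M\rho(m,n)$, for constraint symbols $\lambda,\rho\in\{.,/,\backslash\}$ and integers $m,n\ge 0$, are defined as follows. Consider sorted lists $a_1<\cdots<a_m$ and $b_1<\cdots<b_n$ (all elements distinct, interleaving unknown). The left constraint $\lambda$ means: "." no information, "$\backslash$" it is known that $a_1<b_1$, "/" it is known that $a_1>b_1$. The right constraint $\rho$ means: "." no information, "$\backslash$" it is known that $a_m<b_n$, "/" it is known that $a_m>b_n$. A constraint attached to a problem one of whose lists is empty is vacuous. $\lambda M\rho(m,n)$ is defined when some interleaving satisfies the constraints. Its value is $0$ if the constraints determine the interleaving completely (in particular whenever $m=0$ or $n=0$). Otherwise $\lambda M\rho(m,n)=\min_{1\le i\le m,\,1\le j\le n}\lambda M_{i,j}\rho(m,n)$, where $\lambda M_{i,j}\rho(m,n)=1+\max$ over admissible splittings (for the comparison of $a_i$ with $b_j$) of the sum of the values of the two resulting subproblems. The splittings are: (S) simple: $0\le p\le m$, $0\le q\le n$; subproblem 1 is $(a_1,\dots,a_p;b_1,\dots,b_q)$, subproblem 2 is $(a_{p+1},\dots,a_m;b_{q+1},\dots,b_n)$, meaning every element of subproblem 1 is smaller than every element of subproblem 2; the values are $\lambda M.(p,q)$ and $.M\rho(m-p,n-q)$. (A) with $a_k$ shared: $1\le k\le m$, $1\le q\le n-1$, meaning $b_q<a_k<b_{q+1}$; subproblem 1 is $(a_1,\dots,a_k;b_1,\dots,b_q)$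 with value $\lambda M/(k,q)$ and subproblem 2 is $(a_k,\dots,a_m;b_{q+1},\dots,b_n)$ with value $\backslash M\rho(m-k+1,n-q)$. (B) with $b_l$ shared: $1\le p\le m-1$, $1\le l\le n$, meaning $a_p<b_l<a_{p+1}$; subproblem 1 is $(a_1,\dots,a_p;b_1,\dots,b_l)$ with value $\lambda M\backslash(p,l)$ and subproblem 2 is $(a_{p+1},\dots,a_m;b_l,\dots,b_n)$ with value $/M\rho(m-p,n-l+1)$. A splitting is admissible for the comparison $a_i$ versus $b_j$ if $a_i$ and $b_j$ lie in different subproblems (so neither is the shared element) and some interleaving satisfies both the relations imposed by the splitting and the constraints $\lambda,\rho$. In particular $.M.(m,n)$ is the unconstrained function, and $.M.(m,n)\le M(m,n)$, the optimal worst-case number of comparisons for merging. *)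

theory Defs
  imports Complex_Main
begin

text \<open>
  Constraints on the first pair \<open>(a\<^sub>1, b\<^sub>1)\<close> or on the last pair \<open>(a\<^sub>m, b\<^sub>n)\<close>: Knuth's symbol
  dot is here \<open>Free\<close>, backslash is \<open>Less\<close> (the \<open>a\<close> element is the smaller one), slash is \<open>Greater\<close>.
\<close>

datatype constr = Free | Less | Greater

fun sat :: "constr \<Rightarrow> real \<Rightarrow> real \<Rightarrow> bool" where
  "sat Free x y \<longleftrightarrow> True"
| "sat Less x y \<longleftrightarrow> x < y"
| "sat Greater x y \<longleftrightarrow> x > y"

text \<open>
  The lists are \<open>a 1 < \<dots> < a m\<close> and \<open>b 1 < \<dots> < b n\<close>; values outside the index ranges are irrelevant.
\<close>

definition instance_of :: "nat \<Rightarrow> nat \<Rightarrow> (nat \<Rightarrow> real) \<Rightarrow> (nat \<Rightarrow> real) \<Rightarrow> bool" where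
  "instance_of m n a b \<longleftrightarrow>
     strict_mono_on {1..m} a \<and> strict_mono_on {1..n} b \<and> a ` {1..m} \<inter> b ` {1..n} = {}"

definition compatible ::
  "constr \<Rightarrow> constr \<Rightarrow> nat \<Rightarrow> nat \<Rightarrow> (nat \<Rightarrow> real) \<Rightarrow> (nat \<Rightarrow> real) \<Rightarrow> bool" where
  "compatible lc rc m n a b \<longleftrightarrow>
     instance_of m n a b \<and> (m = 0 \<or> n = 0 \<or> sat lc (a 1) (b 1) \<and> sat rc (a m) (b n))"

text \<open>An interleaving is the outcome of all comparisons of some \<open>a i\<close> with some \<open>b j\<close>.\<close>

definition same_interleaving ::
  "nat \<Rightarrow> nat \<Rightarrow> (nat \<Rightarrow> real) \<Rightarrow> (nat \<Rightarrow> real) \<Rightarrow> (nat \<Rightarrow> real) \<Rightarrow> (nat \<Rightarrow> real) \<Rightarrow> bool" where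
  "same_interleaving m n a b a' b' \<longleftrightarrow>
     (\<forall>i\<in>{1..m}. \<forall>j\<in>{1..n}. a i < b j \<longleftrightarrow> a' i < b' j)"

definition determined :: "constr \<Rightarrow> constr \<Rightarrow> nat \<Rightarrow> nat \<Rightarrow> bool" where
  "determined lc rc m n \<longleftrightarrow>
     (\<forall>a b a' b'. compatible lc rc m n a b \<and> compatible lc rc m n a' b' \<longrightarrow>
        same_interleaving m n a b a' b')"

text \<open>
  \<open>Simple p q\<close> cuts after \<open>a p\<close> and \<open>b q\<close>; \<open>ShareA k q\<close> puts \<open>a k\<close> into both parts and cuts after
  \<open>b q\<close>; \<open>ShareB p k\<close> cuts after \<open>a p\<close> and puts \<open>b k\<close> into both parts.
\<close>

datatype splitting = Simple nat nat | ShareA nat nat | ShareB nat nat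

fun in_range :: "nat \<Rightarrow> nat \<Rightarrow> splitting \<Rightarrow> bool" where
  "in_range m n (Simple p q) \<longleftrightarrow> p \<le> m \<and> q \<le> n"
| "in_range m n (ShareA k q) \<longleftrightarrow> 1 \<le> k \<and> k \<le> m \<and> 1 \<le> q \<and> q < n"
| "in_range m n (ShareB p k) \<longleftrightarrow> 1 \<le> p \<and> p < m \<and> 1 \<le> k \<and> k \<le> n"

fun obeys :: "nat \<Rightarrow> nat \<Rightarrow> (nat \<Rightarrow> real) \<Rightarrow> (nat \<Rightarrow> real) \<Rightarrow> splitting \<Rightarrow> bool" where
  "obeys m n a b (Simple p q) \<longleftrightarrow>
     (\<forall>x\<in>(a ` {1..p} \<union> b ` {1..q}). \<forall>y\<in>(a ` {p+1..m} \<union> b ` {q+1..n}). x < y)"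
| "obeys m n a b (ShareA k q) \<longleftrightarrow> b q < a k \<and> a k < b (q + 1)"
| "obeys m n a b (ShareB p k) \<longleftrightarrow> a p < b k \<and> b k < a (p + 1)"

text \<open>
  The elements \<open>a i\<close> and \<open>b j\<close> lie in different parts; a shared element lies in both parts and is
  never separated from anything.
\<close>

fun separates :: "nat \<Rightarrow> nat \<Rightarrow> splitting \<Rightarrow> bool" where
  "separates i j (Simple p q) \<longleftrightarrow> i \<le> p \<and> q < j \<or> p < i \<and> j \<le> q"
| "separates i j (ShareA k q) \<longleftrightarrow> i < k \<and> q < j \<or> k < i \<and> j \<le> q"
| "separates i j (ShareB p k) \<longleftrightarrow> i \<le> p \<and> k < j \<or> p < i \<and> j < k"

definition admissible ::
  "constr \<Rightarrow> constr \<Rightarrow> nat \<Rightarrow> nat \<Rightarrow> nat \<Rightarrow> nat \<Rightarrow> splitting set" where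
  "admissible lc rc m n i j =
     {s. in_range m n s \<and> separates i j s \<and>
         (\<exists>a b. compatible lc rc m n a b \<and> obeys m n a b s)}"

text \<open>
  \<open>adv_M lc rc m n\<close> is Knuth's function with left constraint \<open>lc\<close> and right constraint \<open>rc\<close>.
  If no interleaving satisfies the constraints, Knuth's function is undefined; here \<open>determined\<close>
  then holds vacuously and the value is \<open>0\<close>. Such subproblems never arise from an admissible
  splitting.
\<close>

function adv_M :: "constr \<Rightarrow> constr \<Rightarrow> nat \<Rightarrow> nat \<Rightarrow> nat" where
  "adv_M lc rc m n =
     (if determined lc rc m n then 0
      else (MIN i\<in>{1..m}. MIN j\<in>{1..n}.
        1 + (MAX s\<in>admissible lc rc m n i j.
          (case s of
             Simple p q \<Rightarrow> adv_M lc Free p q + adv_M Free rc (m - p) (n - q)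
           | ShareA k q \<Rightarrow> adv_M lc Greater k q + adv_M Less rc (m - k + 1) (n - q)
           | ShareB p k \<Rightarrow> adv_M lc Less p k + adv_M Greater rc (m - p) (n - k + 1)))))"
  by pat_completeness auto
termination
  by (relation "measure (\<lambda>(lc, rc, m, n). m + n)") (auto simp: admissible_def)

declare adv_M.simps [simp del]

text \<open>The maximum in \<open>adv_M\<close> is always taken over a finite nonempty set.\<close>

lemma finite_admissible: "finite (admissible lc rc m n i j)"
proof (rule finite_subset)
  let ?I = "{..m} \<times> {..n}"
  show "admissible lc rc m n i j \<subseteq>
    case_prod Simple ` ?I \<union> case_prod ShareA ` ?I \<union> case_prod ShareB ` ?I"
  proof
    fix s assume "s \<in> admissible lc rc m n i j"
    then show "s \<in> case_prod Simple ` ?I \<union> case_prod ShareA ` ?I \<union> case_prod ShareB ` ?I"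
      by (cases s) (auto simp: admissible_def image_iff)
  qed
qed auto

lemma admissible_nonempty:
  assumes c: "compatible lc rc m n a b" and i: "i \<in> {1..m}" and j: "j \<in> {1..n}"
  shows "admissible lc rc m n i j \<noteq> {}"
proof -
  have A: "a x < a y" if "x < y" "x \<in> {1..m}" "y \<in> {1..m}" for x y
    using c that by (auto simp: compatible_def instance_of_def strict_mono_on_def)
  have B: "b x < b y" if "x < y" "x \<in> {1..n}" "y \<in> {1..n}" for x y
    using c that by (auto simp: compatible_def instance_of_def strict_mono_on_def)
  have D: "a x \<noteq> b y" if "x \<in> {1..m}" "y \<in> {1..n}" for x y
    using c that unfolding compatible_def instance_of_def by blast
  have A': "a x \<le> a y" if "x \<le> y" "x \<in> {1..m}" "y \<in> {1..m}" for x y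
    using A[of x y] that by (cases "x = y") auto
  have B': "b x \<le> b y" if "x \<le> y" "x \<in> {1..n}" "y \<in> {1..n}" for x y
    using B[of x y] that by (cases "x = y") auto
  show ?thesis
  proof (cases "a i < b j")
    case True
    define k where "k = (LEAST k. 1 \<le> k \<and> a i < b k)"
    have k: "1 \<le> k" "a i < b k" "k \<le> j"
      using LeastI[of "\<lambda>k. 1 \<le> k \<and> a i < b k" j] Least_le[of "\<lambda>k. 1 \<le> k \<and> a i < b k" j] True j
      by (auto simp: k_def)
    have less: "b y < a i" if "y \<in> {1..k-1}" for y
    proof -
      have "y < k" using that by auto
      then have "\<not> (1 \<le> y \<and> a i < b y)"
        unfolding k_def by (rule not_less_Least)
      then show ?thesis using D[OF i, of y] that k j by fastforce
    qed
    have more: "a i < b y" if "y \<in> {k..n}" for y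
      using B'[of k y] that k j by auto
    have "obeys m n a b (Simple i (k - 1))"
    proof -
      have "x < y" if x: "x \<in> a ` {1..i} \<union> b ` {1..k-1}"
        and y: "y \<in> a ` {i+1..m} \<union> b ` {k-1+1..n}" for x y
      proof -
        have "x \<le> a i" using x less A' i by (fastforce intro: less_imp_le)
        moreover have "a i < y" using y more A[of i] i k(1) by auto
        ultimately show ?thesis by simp
      qed
      then show ?thesis by simp
    qed
    then have "Simple i (k - 1) \<in> admissible lc rc m n i j"
      using c i j k by (auto simp: admissible_def simp del: obeys.simps)
    then show ?thesis by blast
  next
    case False
    then have F: "b j < a i" using D[OF i j] by simp
    define k where "k = (LEAST k. 1 \<le> k \<and> b j < a k)"
    have k: "1 \<le> k" "b j < a k" "k \<le> i"
      using LeastI[of "\<lambda>k. 1 \<le> k \<and> b j < a k" i] Least_le[of "\<lambda>k. 1 \<le> k \<and> b j < a k" i] F i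
      by (auto simp: k_def)
    have less: "a y < b j" if "y \<in> {1..k-1}" for y
    proof -
      have "y < k" using that by auto
      then have "\<not> (1 \<le> y \<and> b j < a y)"
        unfolding k_def by (rule not_less_Least)
      then show ?thesis using D[OF _ j, of y] that k i by fastforce
    qed
    have more: "b j < a y" if "y \<in> {k..m}" for y
      using A'[of k y] that k i by auto
    have "obeys m n a b (Simple (k - 1) j)"
    proof -
      have "x < y" if x: "x \<in> a ` {1..k-1} \<union> b ` {1..j}"
        and y: "y \<in> a ` {k-1+1..m} \<union> b ` {j+1..n}" for x y
      proof -
        have "x \<le> b j" using x less B' j by (fastforce intro: less_imp_le)
        moreover have "b j < y" using y more B[of j] j k(1) by auto
        ultimately show ?thesis by simp
      qed
      then show ?thesis by simp
    qed
    then have "Simple (k - 1) j \<in> admissible lc rc m n i j"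
      using c i j k by (auto simp: admissible_def simp del: obeys.simps)
    then show ?thesis by blast
  qed
qed

end

theory Submission
  imports Defs
begin

text \<open>
  Tape merging bounds the function by \<open>m + n - 1\<close>, and every constraint lowers this bound by one.
  Hence a splitting that shares an element, which lengthens the lists by one but constrains both
  parts, costs at most \<open>m + n - 3\<close> in total. Now compare \<open>a 1\<close> with \<open>b 2\<close>. A simple splitting either
  cuts off two or more elements of \<open>b\<close> and nothing else, which saves a comparison at once, or removes
  at least one element of \<open>a\<close> and at most one of \<open>b\<close>, so that the remainder again satisfies
  \<open>n \<ge> m + 2\<close>. By induction, the value is at most \<open>m + n - 2\<close> whenever \<open>n \<ge> m + 2\<close>.
\<close>

text \<open>Since the value is a minimum over comparisons, one well-chosen pair suffices for an
  upper bound. Of admissibility only range and separation are kept.\<close>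

lemma adv_M_le:
  assumes i: "i \<in> {1..m}" and j: "j \<in> {1..n}"
    and simple: "\<And>p q. p \<le> m \<Longrightarrow> q \<le> n \<Longrightarrow> separates i j (Simple p q) \<Longrightarrow>
      adv_M lc Free p q + adv_M Free rc (m - p) (n - q) < B"
    and shareA: "\<And>k q. in_range m n (ShareA k q) \<Longrightarrow> separates i j (ShareA k q) \<Longrightarrow>
      adv_M lc Greater k q + adv_M Less rc (m - k + 1) (n - q) < B"
    and shareB: "\<And>p k. in_range m n (ShareB p k) \<Longrightarrow> separates i j (ShareB p k) \<Longrightarrow>
      adv_M lc Less p k + adv_M Greater rc (m - p) (n - k + 1) < B"
  shows "adv_M lc rc m n \<le> B"
proof (cases "determined lc rc m n")
  case True
  then show ?thesis by (simp add: adv_M.simps)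
next
  case False
  define cost where "cost s = (case s of
      Simple p q \<Rightarrow> adv_M lc Free p q + adv_M Free rc (m - p) (n - q)
    | ShareA k q \<Rightarrow> adv_M lc Greater k q + adv_M Less rc (m - k + 1) (n - q)
    | ShareB p k \<Rightarrow> adv_M lc Less p k + adv_M Greater rc (m - p) (n - k + 1))" for s
  let ?worst = "\<lambda>i j. 1 + (MAX s\<in>admissible lc rc m n i j. cost s)"
  have "adv_M lc rc m n = (MIN i\<in>{1..m}. MIN j\<in>{1..n}. ?worst i j)"
    using False by (subst adv_M.simps) (simp add: cost_def)
  also have "\<dots> \<le> (MIN j\<in>{1..n}. ?worst i j)"
    using i by (intro Min_le) auto
  also have "\<dots> \<le> ?worst i j"
    using j by (intro Min_le) auto
  also have "\<dots> \<le> B"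
  proof -
    \<comment> \<open>An undetermined problem has a compatible instance, so \<open>Max\<close> is
      not taken over the empty set.\<close>
    obtain a b where "compatible lc rc m n a b"
      using False unfolding determined_def by blast
    then have "admissible lc rc m n i j \<noteq> {}"
      using i j by (rule admissible_nonempty)
    moreover have "cost s < B" if "s \<in> admissible lc rc m n i j" for s
      using that simple shareA shareB
      by (cases s) (auto simp: admissible_def cost_def)
    ultimately show ?thesis
      by (simp add: finite_admissible Suc_le_eq)
  qed
  finally show ?thesis .
qed

lemma adv_M_empty [simp]: "adv_M lc rc 0 n = 0" "adv_M lc rc m 0 = 0"
  by (subst adv_M.simps, simp add: determined_def same_interleaving_def)+

text \<open>First and last pair coincide here, so either constraint settles it; contradictory
  constraints make \<open>determined\<close> vacuous.\<close>

lemma adv_M_one_one_constrained: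
  assumes "lc \<noteq> Free \<or> rc \<noteq> Free"
  shows "adv_M lc rc 1 1 = 0"
proof -
  have "determined lc rc 1 1"
    using assms unfolding determined_def compatible_def same_interleaving_def
    by (cases lc; cases rc) (auto dest: less_asym)
  then show ?thesis
    by (subst adv_M.simps) simp
qed

text \<open>Compare \<open>a 1\<close> with \<open>b 1\<close>: only simple splittings separate
  them, and their first part has an empty list, hence costs nothing. The rest is shorter and keeps
  \<open>rc\<close>.\<close>

lemma adv_M_right_le:
  assumes "m \<ge> 1" "n \<ge> 1"
  shows "adv_M Free rc m n \<le> m + n - (if rc = Free then 1 else 2)"
  using assms
proof (induction "m + n" arbitrary: m n rule: less_induct)
  case (less m n)
  let ?c = "if rc = Free then 1 else 2 :: nat"
  show ?case
  \<comment> \<open>Here the bound is 0, leaving no room for a comparison; otherwise it is positive,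
    which covers an empty remainder.\<close>
  proof (cases "rc \<noteq> Free \<and> m = 1 \<and> n = 1")
    case True
    then show ?thesis by (simp add: adv_M_one_one_constrained flip: One_nat_def)
  next
    case False
    have rest: "adv_M Free rc m' n' < m + n - ?c" if "m' \<le> m" "n' \<le> n" "m' + n' < m + n" for m' n'
    proof (cases "m' = 0 \<or> n' = 0")
      case True
      then show ?thesis using less.prems False by auto
    next
      case nonempty: False
      then show ?thesis using less.hyps[of m' n'] that by auto
    qed
    show ?thesis
    proof (rule adv_M_le[of 1 _ 1])
      fix p q assume "p \<le> m" "q \<le> n" "separates 1 1 (Simple p q)"
      then show "adv_M Free Free p q + adv_M Free rc (m - p) (n - q) < m + n - ?c"
        using rest[of "m - p" "n - q"] by auto
    qed (use less.prems in auto)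
  qed
qed

text \<open>Mirror image: comparing \<open>a m\<close> with \<open>b n\<close> makes the second part
  free of cost.\<close>

lemma adv_M_left_le:
  assumes "m \<ge> 1" "n \<ge> 1"
  shows "adv_M lc Free m n \<le> m + n - (if lc = Free then 1 else 2)"
  using assms
proof (induction "m + n" arbitrary: m n rule: less_induct)
  case (less m n)
  let ?c = "if lc = Free then 1 else 2 :: nat"
  show ?case
  proof (cases "lc \<noteq> Free \<and> m = 1 \<and> n = 1")
    case True
    then show ?thesis by (simp add: adv_M_one_one_constrained flip: One_nat_def)
  next
    case False
    have rest: "adv_M lc Free m' n' < m + n - ?c" if "m' \<le> m" "n' \<le> n" "m' + n' < m + n" for m' n'
    proof (cases "m' = 0 \<or> n' = 0")
      case True
      then show ?thesis using less.prems False by auto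
    next
      case nonempty: False
      then show ?thesis using less.hyps[of m' n'] that by auto
    qed
    show ?thesis
    proof (rule adv_M_le[of m _ n])
      fix p q assume "p \<le> m" "q \<le> n" "separates m n (Simple p q)"
      then show "adv_M lc Free p q + adv_M Free Free (m - p) (n - q) < m + n - ?c"
        using rest[of p q] by auto
    qed (use less.prems in auto)
  qed
qed

lemma adv_M_free_le: "adv_M Free Free m n \<le> m + n - 1"
  using adv_M_right_le[of m n Free] by (cases "m = 0 \<or> n = 0") auto

lemma adv_M_le_diff_2:
  assumes "n \<ge> m + 2"
  shows "adv_M Free Free m n \<le> m + n - 2"
  using assms
proof (induction m arbitrary: n rule: less_induct)
  case (less m)
  show ?case
  proof (cases "m = 0")
    case False
    show ?thesis
    proof (rule adv_M_le[of 1 _ 2])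
      fix p q assume pq: "p \<le> m" "q \<le> n" "separates 1 2 (Simple p q)"
      then consider "p \<ge> 1" "q \<le> 1" | "p = 0" "q \<ge> 2" by fastforce
      then show "adv_M Free Free p q + adv_M Free Free (m - p) (n - q) < m + n - 2"
      proof cases
        case 1
        \<comment> \<open>As \<open>p \<ge> 1 \<ge> q\<close>, the gap of 2 persists: the total is
          at most \<open>(p + q - 1) + (m - p + n - q - 2)\<close>.\<close>
        then show ?thesis
          using less.IH[of "m - p" "n - q"] less.prems adv_M_free_le[of p q] pq by linarith
      next
        case 2
        then show ?thesis
          using adv_M_free_le[of m "n - q"] less.prems False pq by simp
      qed
    next
      fix k q assume "in_range m n (ShareA k q)" "separates 1 2 (ShareA k q)"
      \<comment> \<open>The two constrained bounds are \<open>k - 1\<close> and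
        \<open>m + n - k - 2\<close>.\<close>
      then have "1 < k" "k \<le> m" "q = 1" using False by auto
      then show "adv_M Free Greater k q + adv_M Less Free (m - k + 1) (n - q) < m + n - 2"
        using adv_M_right_le[of k 1 Greater] adv_M_left_le[of "m - k + 1" "n - 1" Less] less.prems
        by fastforce
    next
      fix p k assume "in_range m n (ShareB p k)" "separates 1 2 (ShareB p k)"
      \<comment> \<open>Only \<open>b 1\<close> can be shared below \<open>b 2\<close>; the bounds
        are \<open>p - 1\<close> and \<open>m - p + n - 2\<close>.\<close>
      then have "1 \<le> p" "p < m" "k = 1" using False by auto
      then show "adv_M Free Less p k + adv_M Greater Free (m - p) (n - k + 1) < m + n - 2"
        using adv_M_right_le[of p 1 Less] adv_M_left_le[of "m - p" n Greater] less.prems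
        by fastforce
    qed (use less.prems False in auto)
  qed simp
qed

theorem theorem2:
  fixes m n :: nat
  assumes "m \<ge> 1"
    and "int n \<ge> 9 * \<lceil>real m / 5\<rceil>"
  shows "int (adv_M Free Free m n) < int m + int n - 1"
proof -
  have "real m \<le> 5 * real_of_int \<lceil>real m / 5\<rceil>"
    using le_of_int_ceiling[of "real m / 5"] by linarith
  then have "int m \<le> 5 * \<lceil>real m / 5\<rceil>"
    by linarith
  moreover from this have "\<lceil>real m / 5\<rceil> \<ge> 1"
    using assms(1) by linarith
  \<comment> \<open>With \<open>c\<close> the ceiling,
    \<open>m + 2 \<le> 5 * c + 2 \<le> 9 * c\<close> because \<open>c \<ge> 1\<close>.\<close>
  ultimately have "n \<ge> m + 2"
    using assms(2) by linarith
  then show ?thesis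
    using adv_M_le_diff_2[of m n] by linarith
qed

end
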